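(* Let $n\ge1$ and suppose each player's ideal-action function is identical across dimensions: $y_{j,i}=y_{j,1}$ for all $i\in\{1,\dots,n\}$ and $j\in\{A,P\}$. Let $(m_1^*,F_1^* )$ be a saddle point of the common one-dimensional problem. Then the separate-delegation mechanism $M^*(\hat\theta)=\bigotimes_{i=1}^n m_1^*(\hat\theta_i)$ (the product of the lotteries $m_1^*(\hat\theta_1),\dots,m_1^*(\hat\theta_n)$) is robustly optimal: $M^*\in\mathcal M$ and $$\inf_{F\in\mathcal F(\Theta)}V(M^*,F)=\sup_{M\in\mathcal M}\ \inf_{F\in\mathcal F(\Theta)}V(M,F).$$
   Context: **One-dimensional problem.** $\Theta_1=[0,1]$; $\mathcal A_1\subset\mathbb R$ is a compact interval; $y_{P,1},y_{A,1}:\Theta_1\to\mathcal A_1$ are continuously differentiable and strictly increasing; the bias $b_1:=y_{A,1}-y_{P,1}$ is monotone (weakly increasing or weakly decreasing) and has at most one zero. A one-dimensional mechanism is a Borel probability kernel $m_1:\Theta_1\to\Delta(\mathcal A_1)$ ($\Delta(\cdot)$ denotes Borel probability distributions); it is incentive compatible if $-\int(a-y_{A,1}(t))^2dm_1(a\mid t)\ge-\int(a-y_{A,1}(t))^2dm_1(a\mid\hat t)$ for all $t,\hat t\in\Theta_1$. $\mathcal F(\Theta_1)$ is the set of CDFs of Borel probability distributions on $\Theta_1$, and $V_1(m_1,F_1):=-\int_{\Theta_1}\int_{\mathcal A_1}(a-y_{P,1}(t))^2\,dm_1(a\mid t)\,dF_1(t)$. A saddle point is a pair $(m_1^*,F_1^*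 )$ with $m_1^*$ incentive compatible, $F_1^*\in\mathcal F(\Theta_1)$ and $V_1(m_1^*,F_1)\ge V_1(m_1^*,F_1^* )\ge V_1(m_1,F_1^* )$ for all $F_1\in\mathcal F(\Theta_1)$ and all incentive-compatible $m_1$. **Multidimensional problem.** $\Theta=\prod_{i=1}^n\Theta_i=[0,1]^n$, $\mathcal A=\prod_{i=1}^n\mathcal A_i$ with $\mathcal A_i=\mathcal A_1$ for every $i$. $\mathcal F(\Theta)$ is the set of (joint) Borel probability distributions on $\Theta$. A mechanism is a Borel probability kernel $M:\Theta\to\Delta(\mathcal A)$. For $j\in\{A,P\}$, $u_j(a,\theta)=-\sum_{i=1}^n(a_i-y_{j,i}(\theta_i))^2$ and $U_j^M(\theta,\hat\theta)=\int_{\mathcal A}u_j(a,\theta)\,dM(a\mid\hat\theta)$. $\mathcal M$ is the set of incentive-compatible mechanisms: $U_A^M(\theta,\theta)\ge U_A^M(\theta,\hat\theta)$ for all $\theta,\hat\theta\in\Theta$. $V(M,F):=\int_\Theta U_P^M(\theta,\theta)\,dF(\theta)$. *)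

theory Defs
  imports "HOL-Probability.Probability"
begin

(* Continuous differentiability relative to S, i.e. with one-sided derivatives at the end points
   of an interval; C1_differentiable_on would refer to values of the function outside S. *)
definition C1_within :: "(real \<Rightarrow> real) \<Rightarrow> real set \<Rightarrow> bool" where
  "C1_within f S \<longleftrightarrow>
     (\<exists>f'. (\<forall>t\<in>S. (f has_real_derivative f' t) (at t within S)) \<and> continuous_on S f')"

definition type_space1 :: "real measure" where
  "type_space1 = restrict_space borel {0..1}"

definition action_space1 :: "real set \<Rightarrow> real measure" where
  "action_space1 A = restrict_space borel A"

(* A CDF on [0,1] is identified with the Borel probability measure it determines. *)
definition dists1 :: "real measure set" where
  "dists1 = space (prob_algebra type_space1)"

(* The integral of -(a - y t)^2 over a under the lottery assigned to the report t'. *)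
definition U1 :: "(real \<Rightarrow> real) \<Rightarrow> (real \<Rightarrow> real measure) \<Rightarrow> real \<Rightarrow> real \<Rightarrow> real" where
  "U1 y m t t' = - (\<integral>a. (a - y t)\<^sup>2 \<partial>m t')"

definition IC1 :: "real set \<Rightarrow> (real \<Rightarrow> real) \<Rightarrow> (real \<Rightarrow> real measure) set" where
  "IC1 A yA = {m \<in> type_space1 \<rightarrow>\<^sub>M prob_algebra (action_space1 A).
     \<forall>t\<in>{0..1}. \<forall>t'\<in>{0..1}. U1 yA m t t \<ge> U1 yA m t t'}"

definition V1 :: "(real \<Rightarrow> real) \<Rightarrow> (real \<Rightarrow> real measure) \<Rightarrow> real measure \<Rightarrow> real" where
  "V1 yP m F = - (\<integral>t. (\<integral>a. (a - yP t)\<^sup>2 \<partial>m t) \<partial>F)"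

definition saddle_point1 ::
  "real set \<Rightarrow> (real \<Rightarrow> real) \<Rightarrow> (real \<Rightarrow> real) \<Rightarrow> (real \<Rightarrow> real measure) \<Rightarrow> real measure \<Rightarrow> bool" where
  "saddle_point1 A yP yA m F \<longleftrightarrow> m \<in> IC1 A yA \<and> F \<in> dists1 \<and>
     (\<forall>F'\<in>dists1. V1 yP m F' \<ge> V1 yP m F) \<and>
     (\<forall>m'\<in>IC1 A yA. V1 yP m F \<ge> V1 yP m' F)"

(* Vectors with n coordinates are extensional functions on {1..n}. For the finite index set {1..n},
   the product sigma-algebra of Borel sigma-algebras of subsets of the reals is the Borel
   sigma-algebra of the product. *)
definition type_space :: "nat \<Rightarrow> (nat \<Rightarrow> real) measure" where
  "type_space n = (\<Pi>\<^sub>M i\<in>{1..n}. type_space1)"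

definition action_space :: "nat \<Rightarrow> real set \<Rightarrow> (nat \<Rightarrow> real) measure" where
  "action_space n A = (\<Pi>\<^sub>M i\<in>{1..n}. action_space1 A)"

definition dists :: "nat \<Rightarrow> (nat \<Rightarrow> real) measure set" where
  "dists n = space (prob_algebra (type_space n))"

definition utility ::
  "nat \<Rightarrow> (nat \<Rightarrow> real \<Rightarrow> real) \<Rightarrow> (nat \<Rightarrow> real) \<Rightarrow> (nat \<Rightarrow> real) \<Rightarrow> real" where
  "utility n y a \<theta> = - (\<Sum>i=1..n. (a i - y i (\<theta> i))\<^sup>2)"

definition U ::
  "nat \<Rightarrow> (nat \<Rightarrow> real \<Rightarrow> real) \<Rightarrow> ((nat \<Rightarrow> real) \<Rightarrow> (nat \<Rightarrow> real) measure) \<Rightarrow>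
     (nat \<Rightarrow> real) \<Rightarrow> (nat \<Rightarrow> real) \<Rightarrow> real" where
  "U n y M \<theta> \<theta>' = (\<integral>a. utility n y a \<theta> \<partial>M \<theta>')"

definition IC ::
  "nat \<Rightarrow> real set \<Rightarrow> (nat \<Rightarrow> real \<Rightarrow> real) \<Rightarrow> ((nat \<Rightarrow> real) \<Rightarrow> (nat \<Rightarrow> real) measure) set" where
  "IC n A yA = {M \<in> type_space n \<rightarrow>\<^sub>M prob_algebra (action_space n A).
     \<forall>\<theta>\<in>space (type_space n). \<forall>\<theta>'\<in>space (type_space n). U n yA M \<theta> \<theta> \<ge> U n yA M \<theta> \<theta>'}"

definition V ::
  "nat \<Rightarrow> (nat \<Rightarrow> real \<Rightarrow> real) \<Rightarrow> ((nat \<Rightarrow> real) \<Rightarrow> (nat \<Rightarrow> real) measure) \<Rightarrow>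
     (nat \<Rightarrow> real) measure \<Rightarrow> real" where
  "V n yP M F = (\<integral>\<theta>. U n yP M \<theta> \<theta> \<partial>F)"

definition separate_delegation ::
  "nat \<Rightarrow> (real \<Rightarrow> real measure) \<Rightarrow> (nat \<Rightarrow> real) \<Rightarrow> (nat \<Rightarrow> real) measure" where
  "separate_delegation n m \<theta> = (\<Pi>\<^sub>M i\<in>{1..n}. m (\<theta> i))"

end

theory Submission
  imports Defs
begin

text \<open>
  If types are perfectly correlated across dimensions and distributed according to \<open>F1\<close>, then any
  incentive-compatible \<open>M\<close> yields the principal \<open>n\<close> times the payoff of the one-dimensional
  mechanism that elicits \<open>t\<close>, runs \<open>M\<close> on the constant report \<open>(t, \<dots>, t)\<close> and implements a
  uniformly drawn coordinate of the outcome. This mechanism inherits incentive compatibility from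
  \<open>M\<close>, so the payoff is at most \<open>n\<close> times the saddle value. Separate delegation, whose payoff only
  depends on the marginals of the type distribution, guarantees exactly that amount.
\<close>

section \<open>Products of kernels and integrals against kernels\<close>

text \<open>Boxes form an intersection-stable generator of the product sigma-algebra, and the
  product measure of a box is a finite product of factors that are measurable in \<open>x\<close>.
  It is used to see that separate delegation is a Borel kernel.\<close>

lemma measurable_PiM_kernel:
  assumes I: "finite I"
    and K: "\<And>i. i \<in> I \<Longrightarrow> K i \<in> M \<rightarrow>\<^sub>M prob_algebra (N i)"
  shows "(\<lambda>x. \<Pi>\<^sub>M i\<in>I. K i x) \<in> M \<rightarrow>\<^sub>M prob_algebra (\<Pi>\<^sub>M i\<in>I. N i)"
proof (rule measurable_prob_algebra_generated[OF sets_PiM Int_stable_prod_algebra])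
  show "prod_algebra I N \<subseteq> Pow (\<Pi>\<^sub>E i\<in>I. space (N i))"
    by (rule prod_algebra_sets_into_space)
next
  fix x assume "x \<in> space M"
  then have Kx: "prob_space (K i x)" "sets (K i x) = sets (N i)" if "i \<in> I" for i
    using measurable_space[OF K[OF that]] by (auto simp: space_prob_algebra)
  show "prob_space (\<Pi>\<^sub>M i\<in>I. K i x)"
    by (rule prob_space_PiM) (rule Kx)
  show "sets (\<Pi>\<^sub>M i\<in>I. K i x) = sets (\<Pi>\<^sub>M i\<in>I. N i)"
    by (intro sets_PiM_cong refl Kx)
next
  fix A assume "A \<in> prod_algebra I N"
  then obtain E where A: "A = (\<Pi>\<^sub>E i\<in>I. E i)" and E: "\<And>i. i \<in> I \<Longrightarrow> E i \<in> sets (N i)"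
    by (auto elim!: prod_algebraE_all)
  have "emeasure (\<Pi>\<^sub>M i\<in>I. K i x) A = (\<Prod>i\<in>I. emeasure (K i x) (E i))" if "x \<in> space M" for x
  proof -
    have Kx: "prob_space (K i x)" "sets (K i x) = sets (N i)" if "i \<in> I" for i
      using measurable_space[OF K[OF that] \<open>x \<in> space M\<close>] by (auto simp: space_prob_algebra)
    \<comment> \<open>Embedding a box over its own index set changes nothing, since every side lies
      in its space; so the product formula for embedded boxes applies to \<open>A\<close>
      itself.\<close>
    have "prod_emb I (\<lambda>i. K i x) I (Pi\<^sub>E I E) = Pi\<^sub>E I E"
      using E Kx(2) by (intro prod_emb_PiE_same_index) (metis sets.sets_into_space)
    then show ?thesis
      using emeasure_PiM_emb[of I "\<lambda>i. K i x" I E] I E Kx by (simp add: A)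
  qed
  moreover have "(\<lambda>x. \<Prod>i\<in>I. emeasure (K i x) (E i)) \<in> borel_measurable M"
    using measurable_compose[OF measurable_prob_algebraD[OF K] measurable_emeasure_subprob_algebra] E
    by (intro borel_measurable_prod_ennreal) blast
  ultimately show "(\<lambda>x. emeasure (\<Pi>\<^sub>M i\<in>I. K i x) A) \<in> borel_measurable M"
    by (simp cong: measurable_cong)
qed

text \<open>For a nonnegative integrand the Bochner integral is \<open>enn2real\<close> of the
  nonnegative integral even without integrability, because both are then 0. This reduces the claim
  to the nonnegative integral.\<close>

lemma borel_measurable_integral_kernel:
  fixes f :: "'a \<Rightarrow> 'b \<Rightarrow> real"
  assumes f: "(\<lambda>(x, y). f x y) \<in> borel_measurable (M \<Otimes>\<^sub>M N)"
    and K: "K \<in> M \<rightarrow>\<^sub>M prob_algebra N"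
    and nonneg: "\<And>x y. 0 \<le> f x y"
  shows "(\<lambda>x. \<integral>y. f x y \<partial>K x) \<in> borel_measurable M"
proof -
  have "(\<integral>y. f x y \<partial>K x) = enn2real (\<integral>\<^sup>+y. ennreal (f x y) \<partial>K x)" if x: "x \<in> space M" for x
  proof (rule integral_eq_nn_integral)
    have "sets (K x) = sets N"
      using measurable_space[OF K x] by (simp add: space_prob_algebra)
    moreover have "f x \<in> borel_measurable N"
      using measurable_compose_Pair1[OF x f] by simp
    ultimately show "f x \<in> borel_measurable (K x)"
      by (simp cong: measurable_cong_sets)
  qed (simp add: nonneg)
  moreover have "(\<lambda>x. \<integral>\<^sup>+y. ennreal (f x y) \<partial>K x) \<in> borel_measurable M"
    using f by (intro nn_integral_measurable_subprob_algebra2[OF _ measurable_prob_algebraD[OF K]])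
      (simp add: case_prod_unfold)
  ultimately show ?thesis
    by (simp cong: measurable_cong)
qed

section \<open>Type and action spaces\<close>

lemma space_type_space1 [simp]: "space type_space1 = {0..1}"
  by (simp add: type_space1_def space_restrict_space)

lemma space_action_space1 [simp]: "space (action_space1 A) = A"
  by (simp add: action_space1_def space_restrict_space)

lemma space_type_space: "space (type_space n) = {1..n} \<rightarrow>\<^sub>E {0..1}"
  by (simp add: type_space_def space_PiM)

lemma space_action_space: "space (action_space n A) = {1..n} \<rightarrow>\<^sub>E A"
  by (simp add: action_space_def space_PiM)

lemma measurable_ident_action_space1 [measurable]: "(\<lambda>a. a) \<in> borel_measurable (action_space1 A)"
  unfolding action_space1_def by (rule measurable_restrict_space1) simp

lemma measurable_component_action_space:
  "i \<in> {1..n} \<Longrightarrow> (\<lambda>a. a i) \<in> action_space n A \<rightarrow>\<^sub>M action_space1 A"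
  unfolding action_space_def by (rule measurable_component_singleton)

lemma measurable_component_type_space:
  "i \<in> {1..n} \<Longrightarrow> (\<lambda>\<theta>. \<theta> i) \<in> type_space n \<rightarrow>\<^sub>M type_space1"
  unfolding type_space_def by (rule measurable_component_singleton)

lemma C1_within_imp_measurable:
  assumes "C1_within y {0..1}"
  shows "y \<in> borel_measurable type_space1"
proof -
  have "continuous_on {0..1} y"
    using assms unfolding C1_within_def
    by (metis DERIV_continuous continuous_on_eq_continuous_within)
  then show ?thesis
    unfolding type_space1_def by (rule borel_measurable_continuous_on_restrict)
qed

section \<open>Constant reports and pooled coordinates\<close>

text \<open>Pushing a distribution on [0,1] forward along this map makes types perfectly correlated.
  The restriction to \<open>{1..n}\<close> keeps the vector extensional, hence a point of
  \<open>type_space n\<close>.\<close>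

definition diagonal :: "nat \<Rightarrow> real \<Rightarrow> nat \<Rightarrow> real" where
  "diagonal n t = (\<lambda>i\<in>{1..n}. t)"

lemma measurable_diagonal: "diagonal n \<in> type_space1 \<rightarrow>\<^sub>M type_space n"
  unfolding diagonal_def type_space_def by (rule measurable_restrict) simp

lemma diagonal_in_type_space: "t \<in> {0..1} \<Longrightarrow> diagonal n t \<in> space (type_space n)"
  using measurable_space[OF measurable_diagonal] by simp

text \<open>The equal-weight mixture of the marginals of \<open>M (diagonal n t)\<close>. Written as
  a pushforward of a product measure, it inherits measurability in \<open>t\<close> from pairing and
  \<open>distr\<close>.\<close>

definition pooled_mechanism ::
  "nat \<Rightarrow> real set \<Rightarrow> ((nat \<Rightarrow> real) \<Rightarrow> (nat \<Rightarrow> real) measure) \<Rightarrow> real \<Rightarrow> real measure" where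
  "pooled_mechanism n A M t =
     distr (uniform_count_measure {1..n} \<Otimes>\<^sub>M M (diagonal n t)) (action_space1 A) (\<lambda>(i, a). a i)"

text \<open>The index ranges over a countable discrete space, so joint measurability reduces to
  measurability of each coordinate projection.\<close>

lemma measurable_eval_action_space:
  "(\<lambda>(i, a). a i) \<in> uniform_count_measure {1..n} \<Otimes>\<^sub>M action_space n A \<rightarrow>\<^sub>M action_space1 A"
proof -
  have "(\<lambda>(i, a). a i) \<in> count_space {1..n} \<Otimes>\<^sub>M action_space n A \<rightarrow>\<^sub>M action_space1 A"
    by (rule measurable_pair_measure_countable1) (auto intro: measurable_component_action_space)
  moreover have "sets (uniform_count_measure {1..n} \<Otimes>\<^sub>M action_space n A) =
      sets (count_space {1..n} \<Otimes>\<^sub>M action_space n A)"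
    by (intro sets_pair_measure_cong sets_uniform_count_measure_count_space refl)
  ultimately show ?thesis
    by (simp cong: measurable_cong_sets)
qed

lemma measurable_pooled_mechanism:
  assumes n: "n \<ge> 1" and M: "M \<in> type_space n \<rightarrow>\<^sub>M prob_algebra (action_space n A)"
  shows "pooled_mechanism n A M \<in> type_space1 \<rightarrow>\<^sub>M prob_algebra (action_space1 A)"
proof -
  \<comment> \<open>Here \<open>n \<ge> 1\<close> enters: the uniform draw of a coordinate needs a
    nonempty index set to be a probability measure.\<close>
  have "uniform_count_measure {1..n} \<in> space (prob_algebra (uniform_count_measure {1..n}))"
    using n by (simp add: space_prob_algebra prob_space_uniform_count_measure)
  then have "(\<lambda>t. uniform_count_measure {1..n} \<Otimes>\<^sub>M M (diagonal n t))
      \<in> type_space1 \<rightarrow>\<^sub>M prob_algebra (uniform_count_measure {1..n} \<Otimes>\<^sub>M action_space n A)"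
    by (intro measurable_pair_prob measurable_const measurable_compose[OF measurable_diagonal M])
  from measurable_compose[OF this measurable_distr_prob_space[OF measurable_eval_action_space]]
  show ?thesis
    unfolding pooled_mechanism_def by simp
qed

section \<open>Payoffs as sums of coordinate losses\<close>

text \<open>A bound uniform in \<open>a\<close> makes the quadratic loss integrable against every
  lottery on a compact interval, for any target \<open>c\<close>; the triangle inequality yields
  this crude one.\<close>

lemma square_diff_le:
  fixes a c :: real
  assumes "a \<in> {lo..hi}"
  shows "\<bar>(a - c)\<^sup>2\<bar> \<le> (\<bar>lo\<bar> + \<bar>hi\<bar> + \<bar>c\<bar>)\<^sup>2"
proof -
  have "\<bar>a - c\<bar> \<le> \<bar>lo\<bar> + \<bar>hi\<bar> + \<bar>c\<bar>"
    using assms by auto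
  from power_mono[OF this, of 2] show ?thesis
    by simp
qed

lemma integrable_component_loss:
  assumes K: "K \<in> space (prob_algebra (action_space n {lo..hi}))" and i: "i \<in> {1..n}"
  shows "integrable K (\<lambda>a. (a i - c)\<^sup>2)"
proof -
  interpret prob_space K
    using K by (simp add: space_prob_algebra)
  have K_sets [measurable_cong]: "sets K = sets (action_space n {lo..hi})"
    using K by (simp add: space_prob_algebra)
  note [measurable] = measurable_component_action_space[OF i]
  have "a i \<in> {lo..hi}" if "a \<in> space K" for a
    using that i by (simp add: sets_eq_imp_space_eq[OF K_sets] space_action_space PiE_iff)
  then show ?thesis
    by (intro integrable_const_bound[where B = "(\<bar>lo\<bar> + \<bar>hi\<bar> + \<bar>c\<bar>)\<^sup>2"])
      (use square_diff_le in \<open>auto simp: real_norm_def\<close>)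
qed

text \<open>Since the loss is additively separable, only the marginals of the lottery
  matter.\<close>

lemma U_eq_sum:
  assumes "M \<theta>' \<in> space (prob_algebra (action_space n {lo..hi}))"
  shows "U n y M \<theta> \<theta>' = - (\<Sum>i=1..n. \<integral>a. (a i - y i (\<theta> i))\<^sup>2 \<partial>M \<theta>')"
proof -
  have "(\<integral>a. (\<Sum>i=1..n. (a i - y i (\<theta> i))\<^sup>2) \<partial>M \<theta>') = (\<Sum>i=1..n. \<integral>a. (a i - y i (\<theta> i))\<^sup>2 \<partial>M \<theta>')"
    by (rule Bochner_Integration.integral_sum) (rule integrable_component_loss[OF assms])
  then show ?thesis
    unfolding U_def utility_def by simp
qed

text \<open>Ideal actions are assumed to coincide across dimensions on [0,1] only, so a common
  function may replace them at true types in \<open>type_space n\<close>; the report enters through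
  the lottery alone.\<close>

lemma U_cong:
  assumes "\<theta> \<in> space (type_space n)" "\<forall>i\<in>{1..n}. \<forall>t\<in>{0..1}. y i t = z t"
  shows "U n y M \<theta> \<theta>' = U n (\<lambda>i. z) M \<theta> \<theta>'"
  using assms by (auto simp: U_def utility_def space_type_space PiE_iff intro!: Bochner_Integration.integral_cong sum.cong)

section \<open>Payoffs and incentives of the pooled mechanism\<close>

text \<open>A uniformly drawn coordinate has as expected loss the mean of the coordinate losses, all
  measured from the same target \<open>y t\<close>; the factor \<open>n\<close> turns the mean into
  the sum. Allowing \<open>t'\<close> to differ from \<open>t\<close> lets the identity transfer
  incentives as well as payoffs.\<close>

lemma U1_pooled_mechanism:
  assumes n: "n \<ge> 1"
    and M: "M (diagonal n t') \<in> space (prob_algebra (action_space n {lo..hi}))"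
  shows "real n * U1 y (pooled_mechanism n {lo..hi} M) t t' = U n (\<lambda>i. y) M (diagonal n t) (diagonal n t')"
proof -
  let ?N = "uniform_count_measure {1..n}" and ?K = "M (diagonal n t')"
  interpret N: prob_space ?N
    using n by (simp add: prob_space_uniform_count_measure)
  interpret K: prob_space ?K
    using M by (simp add: space_prob_algebra)
  interpret pair_prob_space ?N ?K ..
  have K_sets: "sets ?K = sets (action_space n {lo..hi})"
    using M by (simp add: space_prob_algebra)
  have eval: "(\<lambda>(i, a). a i) \<in> ?N \<Otimes>\<^sub>M ?K \<rightarrow>\<^sub>M action_space1 {lo..hi}"
    using measurable_eval_action_space
      measurable_cong_sets[OF sets_pair_measure_cong[OF refl K_sets] refl]
    by blast
  have loss: "(\<lambda>a. (a - y t)\<^sup>2) \<in> borel_measurable (action_space1 {lo..hi})"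
    by measurable
  have "integrable (?N \<Otimes>\<^sub>M ?K) (\<lambda>(i, a). (a i - y t)\<^sup>2)"
  proof (rule integrable_const_bound[where B = "(\<bar>lo\<bar> + \<bar>hi\<bar> + \<bar>y t\<bar>)\<^sup>2"])
    show "AE x in ?N \<Otimes>\<^sub>M ?K. norm (case x of (i, a) \<Rightarrow> (a i - y t)\<^sup>2) \<le> (\<bar>lo\<bar> + \<bar>hi\<bar> + \<bar>y t\<bar>)\<^sup>2"
    proof (rule AE_I2)
      fix x assume "x \<in> space (?N \<Otimes>\<^sub>M ?K)"
      then have "(\<lambda>(i, a). a i) x \<in> {lo..hi}"
        using measurable_space[OF eval] by simp
      then show "norm (case x of (i, a) \<Rightarrow> (a i - y t)\<^sup>2) \<le> (\<bar>lo\<bar> + \<bar>hi\<bar> + \<bar>y t\<bar>)\<^sup>2"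
        using square_diff_le by (auto split: prod.split)
    qed
    show "(\<lambda>(i, a). (a i - y t)\<^sup>2) \<in> borel_measurable (?N \<Otimes>\<^sub>M ?K)"
      using measurable_compose[OF eval loss] by (simp add: case_prod_unfold)
  qed
  \<comment> \<open>The drawn index is integrated last, so the outer integral is a finite average
    over \<open>{1..n}\<close>.\<close>
  note fubini = integral_fst'[OF this]
  have "(\<integral>a. (a - y t)\<^sup>2 \<partial>pooled_mechanism n {lo..hi} M t') =
      (\<integral>x. ((\<lambda>(i, a). a i) x - y t)\<^sup>2 \<partial>(?N \<Otimes>\<^sub>M ?K))"
    unfolding pooled_mechanism_def by (rule integral_distr[OF eval loss])
  also have "\<dots> = (\<integral>(i, a). (a i - y t)\<^sup>2 \<partial>(?N \<Otimes>\<^sub>M ?K))"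
    by (simp only: case_prod_unfold)
  also have "\<dots> = (\<Sum>i=1..n. \<integral>a. (a i - y t)\<^sup>2 \<partial>?K) / real n"
    using fubini by (simp add: integral_uniform_count_measure)
  also have "(\<Sum>i=1..n. \<integral>a. (a i - y t)\<^sup>2 \<partial>?K) = - U n (\<lambda>i. y) M (diagonal n t) (diagonal n t')"
    unfolding U_eq_sum[of M "diagonal n t'", OF M] by (simp add: diagonal_def)
  finally show ?thesis
    using n by (simp add: U1_def)
qed

lemma pooled_mechanism_in_IC1:
  assumes n: "n \<ge> 1" and M: "M \<in> IC n {lo..hi} yA"
    and yA: "\<forall>i\<in>{1..n}. \<forall>t\<in>{0..1}. yA i t = y t"
  shows "pooled_mechanism n {lo..hi} M \<in> IC1 {lo..hi} y"
  unfolding IC1_def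
proof (intro CollectI conjI ballI)
  have kernel: "M \<in> type_space n \<rightarrow>\<^sub>M prob_algebra (action_space n {lo..hi})"
    using M by (simp add: IC_def)
  show "pooled_mechanism n {lo..hi} M \<in> type_space1 \<rightarrow>\<^sub>M prob_algebra (action_space1 {lo..hi})"
    by (rule measurable_pooled_mechanism[OF n kernel])
  fix t t' :: real assume t: "t \<in> {0..1}" "t' \<in> {0..1}"
  note diag = diagonal_in_type_space[OF t(1), of n] diagonal_in_type_space[OF t(2), of n]
  \<comment> \<open>A one-dimensional misreport corresponds to the same misreport in every
    coordinate, so incentive compatibility of \<open>M\<close> is applied between constant
    vectors.\<close>
  have "U n yA M (diagonal n t) (diagonal n t') \<le> U n yA M (diagonal n t) (diagonal n t)"
    using M diag by (auto simp: IC_def)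
  then have "real n * U1 y (pooled_mechanism n {lo..hi} M) t t' \<le>
      real n * U1 y (pooled_mechanism n {lo..hi} M) t t"
    using U1_pooled_mechanism[OF n measurable_space[OF kernel]] diag
    by (simp add: U_cong[OF diag(1) yA])
  then show "U1 y (pooled_mechanism n {lo..hi} M) t t' \<le> U1 y (pooled_mechanism n {lo..hi} M) t t"
    using n by simp
qed

text \<open>Each coordinate loss is the integral of a jointly measurable nonnegative function
  against the kernel \<open>M\<close>. This licenses the change of variables along
  \<open>diagonal\<close>.\<close>

lemma measurable_U:
  assumes M: "M \<in> type_space n \<rightarrow>\<^sub>M prob_algebra (action_space n {lo..hi})"
    and y: "y \<in> borel_measurable type_space1"
  shows "(\<lambda>\<theta>. U n (\<lambda>i. y) M \<theta> \<theta>) \<in> borel_measurable (type_space n)"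
proof -
  have "(\<lambda>\<theta>. \<integral>a. (a i - y (\<theta> i))\<^sup>2 \<partial>M \<theta>) \<in> borel_measurable (type_space n)" if i: "i \<in> {1..n}" for i
  proof (rule borel_measurable_integral_kernel[OF _ M])
    have [measurable]: "(\<lambda>\<theta>. y (\<theta> i)) \<in> borel_measurable (type_space n)"
      by (rule measurable_compose[OF measurable_component_type_space[OF i] y])
    have [measurable]: "(\<lambda>a. a i) \<in> borel_measurable (action_space n {lo..hi})"
      by (rule measurable_compose[OF measurable_component_action_space[OF i] measurable_ident_action_space1])
    show "(\<lambda>(\<theta>, a). (a i - y (\<theta> i))\<^sup>2) \<in> borel_measurable (type_space n \<Otimes>\<^sub>M action_space n {lo..hi})"
      by measurable
  qed simp
  then have "(\<lambda>\<theta>. - (\<Sum>i=1..n. \<integral>a. (a i - y (\<theta> i))\<^sup>2 \<partial>M \<theta>)) \<in> borel_measurable (type_space n)"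
    by (intro borel_measurable_uminus borel_measurable_sum)
  then show ?thesis
    by (simp add: U_eq_sum[OF measurable_space[OF M]] cong: measurable_cong)
qed

text \<open>Changing variables along the diagonal leaves an integral over \<open>t\<close> of
  payoffs at constant vectors, and these are \<open>n\<close> times the pooled payoffs
  pointwise.\<close>

lemma V_diagonal:
  assumes n: "n \<ge> 1" and M: "M \<in> type_space n \<rightarrow>\<^sub>M prob_algebra (action_space n {lo..hi})"
    and y: "y \<in> borel_measurable type_space1"
    and yP: "\<forall>i\<in>{1..n}. \<forall>t\<in>{0..1}. yP i t = y t"
    and F: "F \<in> dists1"
  shows "V n yP M (distr F (type_space n) (diagonal n)) =
    real n * V1 y (pooled_mechanism n {lo..hi} M) F"
proof -
  have F_sets: "sets F = sets type_space1"
    using F by (simp add: dists1_def space_prob_algebra)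
  have F_space: "space F = {0..1}"
    using sets_eq_imp_space_eq[OF F_sets] by simp
  have diag: "diagonal n \<in> F \<rightarrow>\<^sub>M type_space n"
    using measurable_diagonal by (simp add: measurable_cong_sets[OF F_sets refl])
  have "V n yP M (distr F (type_space n) (diagonal n)) =
      (\<integral>\<theta>. U n (\<lambda>i. y) M \<theta> \<theta> \<partial>distr F (type_space n) (diagonal n))"
    unfolding V_def by (rule Bochner_Integration.integral_cong) (simp_all add: U_cong[OF _ yP])
  also have "\<dots> = (\<integral>t. U n (\<lambda>i. y) M (diagonal n t) (diagonal n t) \<partial>F)"
    by (rule integral_distr[OF diag measurable_U[OF M y]])
  also have "\<dots> = (\<integral>t. real n * U1 y (pooled_mechanism n {lo..hi} M) t t \<partial>F)"
    by (rule Bochner_Integration.integral_cong)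
      (simp_all add: F_space U1_pooled_mechanism[OF n] measurable_space[OF M] diagonal_in_type_space)
  also have "\<dots> = real n * V1 y (pooled_mechanism n {lo..hi} M) F"
    by (simp add: U1_def V1_def)
  finally show ?thesis .
qed

section \<open>Incentives and payoffs under separate delegation\<close>

lemma measurable_separate_delegation:
  assumes m: "m \<in> type_space1 \<rightarrow>\<^sub>M prob_algebra (action_space1 A)"
  shows "separate_delegation n m \<in> type_space n \<rightarrow>\<^sub>M prob_algebra (action_space n A)"
  using measurable_PiM_kernel[of "{1..n}" "\<lambda>i \<theta>. m (\<theta> i)" "type_space n" "\<lambda>i. action_space1 A"]
    measurable_compose[OF measurable_component_type_space m]
  by (simp add: separate_delegation_def[abs_def] action_space_def)

text \<open>The marginal of the product lottery in coordinate \<open>i\<close> is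
  \<open>m (\<theta>' i)\<close>, and separability of the loss makes the marginals
  sufficient.\<close>

lemma U_separate_delegation:
  assumes m: "m \<in> type_space1 \<rightarrow>\<^sub>M prob_algebra (action_space1 {lo..hi})"
    and \<theta>': "\<theta>' \<in> space (type_space n)"
  shows "U n y (separate_delegation n m) \<theta> \<theta>' = (\<Sum>i=1..n. U1 (y i) m (\<theta> i) (\<theta>' i))"
proof -
  have m\<theta>: "prob_space (m (\<theta>' i))" "sets (m (\<theta>' i)) = sets (action_space1 {lo..hi})" if "i \<in> {1..n}" for i
    using measurable_space[OF m, of "\<theta>' i"] \<theta>' that
    by (auto simp: space_type_space PiE_iff space_prob_algebra)
  have "(\<integral>a. (a i - y i (\<theta> i))\<^sup>2 \<partial>separate_delegation n m \<theta>') = (\<integral>b. (b - y i (\<theta> i))\<^sup>2 \<partial>m (\<theta>' i))"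
    if i: "i \<in> {1..n}" for i
  proof -
    have marginal: "m (\<theta>' i) = distr (separate_delegation n m \<theta>') (m (\<theta>' i)) (\<lambda>a. a i)"
      unfolding separate_delegation_def
      using distr_PiM_component[of "{1..n}" "\<lambda>i. m (\<theta>' i)" i] m\<theta>(1) i by simp
    have "(\<lambda>a. a i) \<in> separate_delegation n m \<theta>' \<rightarrow>\<^sub>M m (\<theta>' i)"
      unfolding separate_delegation_def using i by (rule measurable_component_singleton)
    moreover have "(\<lambda>b. (b - y i (\<theta> i))\<^sup>2) \<in> borel_measurable (m (\<theta>' i))"
      by (subst measurable_cong_sets[OF m\<theta>(2)[OF i] refl]) measurable
    ultimately show ?thesis
      using integral_distr[of "\<lambda>a. a i" "separate_delegation n m \<theta>'" "m (\<theta>' i)" "\<lambda>b. (b - y i (\<theta> i))\<^sup>2"]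
      by (simp add: marginal[symmetric])
  qed
  then show ?thesis
    by (simp add: U_eq_sum[of "separate_delegation n m" \<theta>', OF measurable_space[OF measurable_separate_delegation[OF m] \<theta>']]
        U1_def sum_negf)
qed

text \<open>Each coordinate of the report affects only its own summand, so truth-telling is optimal
  summand by summand.\<close>

lemma separate_delegation_in_IC:
  assumes m: "m \<in> IC1 {lo..hi} y" and yA: "\<forall>i\<in>{1..n}. \<forall>t\<in>{0..1}. yA i t = y t"
  shows "separate_delegation n m \<in> IC n {lo..hi} yA"
  unfolding IC_def
proof (intro CollectI conjI ballI)
  have kernel: "m \<in> type_space1 \<rightarrow>\<^sub>M prob_algebra (action_space1 {lo..hi})"
    using m by (simp add: IC1_def)
  show "separate_delegation n m \<in> type_space n \<rightarrow>\<^sub>M prob_algebra (action_space n {lo..hi})"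
    by (rule measurable_separate_delegation[OF kernel])
  fix \<theta> \<theta>' assume \<theta>: "\<theta> \<in> space (type_space n)" "\<theta>' \<in> space (type_space n)"
  have "(\<Sum>i=1..n. U1 y m (\<theta> i) (\<theta>' i)) \<le> (\<Sum>i=1..n. U1 y m (\<theta> i) (\<theta> i))"
    using m \<theta> by (intro sum_mono) (auto simp: IC1_def space_type_space PiE_iff)
  then show "U n yA (separate_delegation n m) \<theta> \<theta>' \<le> U n yA (separate_delegation n m) \<theta> \<theta>"
    by (simp add: U_cong[OF \<theta>(1) yA] U_separate_delegation[OF kernel] \<theta>)
qed

text \<open>Needed to interchange the sum over coordinates with the integral over types.\<close>

lemma integrable_U1:
  assumes m: "m \<in> type_space1 \<rightarrow>\<^sub>M prob_algebra (action_space1 {lo..hi})"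
    and y: "y \<in> borel_measurable type_space1" "y ` {0..1} \<subseteq> {lo..hi}"
    and F: "F \<in> dists1"
  shows "integrable F (\<lambda>t. U1 y m t t)"
proof -
  interpret prob_space F
    using F by (simp add: dists1_def space_prob_algebra)
  have F_sets: "sets F = sets type_space1"
    using F by (simp add: dists1_def space_prob_algebra)
  have F_space: "space F = {0..1}"
    using sets_eq_imp_space_eq[OF F_sets] by simp
  note [measurable] = y(1)
  have "(\<lambda>t. \<integral>a. (a - y t)\<^sup>2 \<partial>m t) \<in> borel_measurable type_space1"
    by (rule borel_measurable_integral_kernel[OF _ m]) simp_all
  then have "(\<lambda>t. U1 y m t t) \<in> borel_measurable F"
    unfolding U1_def by (simp add: measurable_cong_sets[OF F_sets refl])
  \<comment> \<open>Actions and ideal actions both lie in \<open>{lo..hi}\<close>, so the loss is at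
    most the squared length of the interval, uniformly in \<open>t\<close>.\<close>
  moreover have "norm (U1 y m t t) \<le> (hi - lo)\<^sup>2" if t: "t \<in> space F" for t
  proof -
    have mt: "prob_space (m t)" "sets (m t) = sets (action_space1 {lo..hi})"
      using measurable_space[OF m, of t] t by (auto simp: F_space space_prob_algebra)
    interpret m: prob_space "m t" by (rule mt)
    have bound: "\<bar>(a - y t)\<^sup>2\<bar> \<le> (hi - lo)\<^sup>2" if "a \<in> space (m t)" for a
    proof -
      have "a \<in> {lo..hi}"
        using that sets_eq_imp_space_eq[OF mt(2)] by simp
      moreover have "y t \<in> {lo..hi}"
        using y(2) t by (simp add: F_space image_subset_iff)
      ultimately have "\<bar>a - y t\<bar> \<le> hi - lo"
        by auto
      from power_mono[OF this, of 2] show ?thesis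
        by simp
    qed
    have "(\<lambda>a. (a - y t)\<^sup>2) \<in> borel_measurable (m t)"
      by (subst measurable_cong_sets[OF mt(2) refl]) measurable
    then have "integrable (m t) (\<lambda>a. (a - y t)\<^sup>2)"
      using bound by (intro m.integrable_const_bound[where B = "(hi - lo)\<^sup>2"] AE_I2) auto
    then have "(\<integral>a. (a - y t)\<^sup>2 \<partial>m t) \<le> (hi - lo)\<^sup>2"
      using bound by (intro m.integral_le_const AE_I2) auto
    moreover have "0 \<le> (\<integral>a. (a - y t)\<^sup>2 \<partial>m t)"
      by simp
    ultimately show ?thesis
      by (simp add: U1_def)
  qed
  ultimately show ?thesis
    by (intro integrable_const_bound[where B = "(hi - lo)\<^sup>2"]) auto
qed

text \<open>The payoff at a type vector is a sum of functions of single coordinates, so correlation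
  is irrelevant and only the marginals of \<open>F\<close> count. The second claim makes each
  marginal an admissible choice for nature in the one-dimensional problem.\<close>

lemma V_separate_delegation:
  assumes m: "m \<in> type_space1 \<rightarrow>\<^sub>M prob_algebra (action_space1 {lo..hi})"
    and y: "y \<in> borel_measurable type_space1" "y ` {0..1} \<subseteq> {lo..hi}"
    and yP: "\<forall>i\<in>{1..n}. \<forall>t\<in>{0..1}. yP i t = y t"
    and F: "F \<in> dists n"
  shows "V n yP (separate_delegation n m) F =
    (\<Sum>i=1..n. V1 y m (distr F type_space1 (\<lambda>\<theta>. \<theta> i)))"
    and "i \<in> {1..n} \<Longrightarrow> distr F type_space1 (\<lambda>\<theta>. \<theta> i) \<in> dists1"
proof -
  interpret prob_space F
    using F by (simp add: dists_def space_prob_algebra)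
  have F_sets: "sets F = sets (type_space n)"
    using F by (simp add: dists_def space_prob_algebra)
  have F_space: "space F = space (type_space n)"
    using sets_eq_imp_space_eq[OF F_sets] .
  have proj: "(\<lambda>\<theta>. \<theta> i) \<in> F \<rightarrow>\<^sub>M type_space1" if "i \<in> {1..n}" for i
    using measurable_component_type_space[OF that] by (simp add: measurable_cong_sets[OF F_sets refl])
  show marginal: "distr F type_space1 (\<lambda>\<theta>. \<theta> i) \<in> dists1" if "i \<in> {1..n}" for i
    unfolding dists1_def using prob_space_distr[OF proj[OF that]] by (simp add: space_prob_algebra)
  have int: "integrable (distr F type_space1 (\<lambda>\<theta>. \<theta> i)) (\<lambda>t. U1 y m t t)" if "i \<in> {1..n}" for i
    by (rule integrable_U1[OF m y marginal[OF that]])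
  \<comment> \<open>The function does not involve \<open>i\<close>; the index only supplies a
    distribution on [0,1] from whose integrability statement measurability is read off.\<close>
  have meas: "(\<lambda>t. U1 y m t t) \<in> borel_measurable type_space1" if "i \<in> {1..n}" for i
    using borel_measurable_integrable[OF int[OF that]] by simp
  have "V n yP (separate_delegation n m) F = (\<integral>\<theta>. (\<Sum>i=1..n. U1 y m (\<theta> i) (\<theta> i)) \<partial>F)"
    unfolding V_def
  proof (rule Bochner_Integration.integral_cong[OF refl])
    fix \<theta> assume "\<theta> \<in> space F"
    then have \<theta>: "\<theta> \<in> space (type_space n)"
      by (simp add: F_space)
    show "U n yP (separate_delegation n m) \<theta> \<theta> = (\<Sum>i=1..n. U1 y m (\<theta> i) (\<theta> i))"
      unfolding U_cong[OF \<theta> yP] by (rule U_separate_delegation[OF m \<theta>])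
  qed
  also have "\<dots> = (\<Sum>i=1..n. \<integral>\<theta>. U1 y m (\<theta> i) (\<theta> i) \<partial>F)"
    using int by (intro Bochner_Integration.integral_sum) (rule integrable_distr[OF proj])
  also have "\<dots> = (\<Sum>i=1..n. V1 y m (distr F type_space1 (\<lambda>\<theta>. \<theta> i)))"
  proof (rule sum.cong[OF refl])
    fix i assume i: "i \<in> {1..n}"
    have "(\<integral>\<theta>. U1 y m (\<theta> i) (\<theta> i) \<partial>F) = (\<integral>t. U1 y m t t \<partial>distr F type_space1 (\<lambda>\<theta>. \<theta> i))"
      by (rule integral_distr[OF proj[OF i] meas[OF i], symmetric])
    then show "(\<integral>\<theta>. U1 y m (\<theta> i) (\<theta> i) \<partial>F) = V1 y m (distr F type_space1 (\<lambda>\<theta>. \<theta> i))"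
      by (simp add: U1_def V1_def)
  qed
  finally show "V n yP (separate_delegation n m) F =
    (\<Sum>i=1..n. V1 y m (distr F type_space1 (\<lambda>\<theta>. \<theta> i)))" .
qed

section \<open>Saddle value and robust optimality\<close>

theorem proposition2:
  fixes n :: nat
    and lo hi :: real
    and yP yA :: "nat \<Rightarrow> real \<Rightarrow> real"
    and m :: "real \<Rightarrow> real measure"
    and F1 :: "real measure"
  assumes n: "n \<ge> 1"
    and interval: "lo \<le> hi"
    and range_P: "yP 1 ` {0..1} \<subseteq> {lo..hi}"
    and range_A: "yA 1 ` {0..1} \<subseteq> {lo..hi}"
    and C1_P: "C1_within (yP 1) {0..1}"
    and C1_A: "C1_within (yA 1) {0..1}"
    and incr_P: "strict_mono_on {0..1} (yP 1)"
    and incr_A: "strict_mono_on {0..1} (yA 1)"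
    and bias_monotone: "mono_on {0..1} (\<lambda>t. yA 1 t - yP 1 t) \<or>
                        antimono_on {0..1} (\<lambda>t. yA 1 t - yP 1 t)"
    and bias_zero: "\<forall>s\<in>{0..1}. \<forall>t\<in>{0..1}. yA 1 s - yP 1 s = 0 \<and> yA 1 t - yP 1 t = 0 \<longrightarrow> s = t"
    and identical_P: "\<forall>i\<in>{1..n}. \<forall>t\<in>{0..1}. yP i t = yP 1 t"
    and identical_A: "\<forall>i\<in>{1..n}. \<forall>t\<in>{0..1}. yA i t = yA 1 t"
    and saddle: "saddle_point1 {lo..hi} (yP 1) (yA 1) m F1"
  shows "separate_delegation n m \<in> IC n {lo..hi} yA \<and>
    (INF F\<in>dists n. ereal (V n yP (separate_delegation n m) F)) =
    (SUP M\<in>IC n {lo..hi} yA. INF F\<in>dists n. ereal (V n yP M F))"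
proof
  have m_IC: "m \<in> IC1 {lo..hi} (yA 1)" and F1: "F1 \<in> dists1"
    and nature: "\<And>F. F \<in> dists1 \<Longrightarrow> V1 (yP 1) m F1 \<le> V1 (yP 1) m F"
    and principal: "\<And>m'. m' \<in> IC1 {lo..hi} (yA 1) \<Longrightarrow> V1 (yP 1) m' F1 \<le> V1 (yP 1) m F1"
    using saddle by (auto simp: saddle_point1_def)
  have kernel: "m \<in> type_space1 \<rightarrow>\<^sub>M prob_algebra (action_space1 {lo..hi})"
    using m_IC by (simp add: IC1_def)
  note yP_meas = C1_within_imp_measurable[OF C1_P]
  show sep_IC: "separate_delegation n m \<in> IC n {lo..hi} yA"
    by (rule separate_delegation_in_IC[OF m_IC identical_A])
  \<comment> \<open>Nature's half of the saddle inequality, applied to each of the \<open>n\<close>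
    marginals of \<open>F\<close>.\<close>
  have lower: "real n * V1 (yP 1) m F1 \<le> V n yP (separate_delegation n m) F" if "F \<in> dists n" for F
  proof -
    note V = V_separate_delegation[OF kernel yP_meas range_P identical_P that]
    have "(\<Sum>i=1..n. V1 (yP 1) m F1) \<le> (\<Sum>i=1..n. V1 (yP 1) m (distr F type_space1 (\<lambda>\<theta>. \<theta> i)))"
      by (intro sum_mono nature V(2))
    then show ?thesis
      by (simp add: V(1))
  qed
  have diag: "distr F1 (type_space n) (diagonal n) \<in> dists n"
    using measurable_space[OF measurable_distr_prob_space[OF measurable_diagonal]] F1
    by (simp add: dists_def dists1_def)
  \<comment> \<open>The principal's half of the saddle inequality, applied to the pooled mechanism
    of \<open>M\<close>.\<close>
  have upper: "V n yP M (distr F1 (type_space n) (diagonal n)) \<le> real n * V1 (yP 1) m F1"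
    if M: "M \<in> IC n {lo..hi} yA" for M
  proof -
    have "M \<in> type_space n \<rightarrow>\<^sub>M prob_algebra (action_space n {lo..hi})"
      using M by (simp add: IC_def)
    then show ?thesis
      using principal[OF pooled_mechanism_in_IC1[OF n M identical_A]]
      by (simp add: V_diagonal[OF n _ yP_meas identical_P F1] mult_left_mono)
  qed
  show "(INF F\<in>dists n. ereal (V n yP (separate_delegation n m) F)) =
    (SUP M\<in>IC n {lo..hi} yA. INF F\<in>dists n. ereal (V n yP M F))"
  proof (rule antisym)
    show "(INF F\<in>dists n. ereal (V n yP (separate_delegation n m) F)) \<le>
      (SUP M\<in>IC n {lo..hi} yA. INF F\<in>dists n. ereal (V n yP M F))"
      by (rule SUP_upper[OF sep_IC])
    show "(SUP M\<in>IC n {lo..hi} yA. INF F\<in>dists n. ereal (V n yP M F)) \<le>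
      (INF F\<in>dists n. ereal (V n yP (separate_delegation n m) F))"
    proof (intro SUP_least INF_greatest)
      fix M F assume M: "M \<in> IC n {lo..hi} yA" and F: "F \<in> dists n"
      \<comment> \<open>The same correlated distribution caps every \<open>M\<close>, whatever
        \<open>F\<close> separate delegation faces; \<open>n\<close> times the saddle value lies
        between the two payoffs.\<close>
      have "(INF F\<in>dists n. ereal (V n yP M F)) \<le>
          ereal (V n yP M (distr F1 (type_space n) (diagonal n)))"
        by (rule INF_lower[OF diag])
      also have "\<dots> \<le> ereal (V n yP (separate_delegation n m) F)"
        using upper[OF M] lower[OF F] by simp
      finally show "(INF F\<in>dists n. ereal (V n yP M F)) \<le>
          ereal (V n yP (separate_delegation n m) F)" .
    qed
  qed
qed

end
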